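(* Let $s,n$ be positive integers and $K$ a real number with $2\leq K\leq \frac{s}{2^{120}(\log n)^3}$, and let $J\subset [n]=\{1,\dots,n\}$ be chosen uniformly at random among all sets with $|J|=s$ and $|J+J|\leq K|J|$. Then with probability at least $1-\exp(-K^{1/6}s^{5/6}\sqrt{\log n})$ there is a set $T\subset J$ with $|T|\leq 2^{15} K^{1/6}s^{5/6}\sqrt{\log n}$ such that $J\setminus T$ is contained in an arithmetic progression (of integers) of size at most \[\frac{Ks}{2}+2^{17}K^{7/6}s^{5/6}\sqrt{\log n}.\]
   Context: $J+J=\{a+b: a,b\in J\}$; $\log$ is the natural logarithm. *)

theory Defs
  imports Complex_Main
begin

definition sumset :: "int set \<Rightarrow> int set \<Rightarrow> int set" where
  "sumset A B = {a + b | a b. a \<in> A \<and> b \<in> B}"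

definition arith_prog :: "int \<Rightarrow> int \<Rightarrow> nat \<Rightarrow> int set" where
  "arith_prog a d m = {a + int i * d | i. i < m}"

definition small_doubling_sets :: "nat \<Rightarrow> nat \<Rightarrow> real \<Rightarrow> int set set" where
  "small_doubling_sets n s K =
     {J. J \<subseteq> {1..int n} \<and> card J = s \<and> real (card (sumset J J)) \<le> K * real (card J)}"

end

theory Submission
  imports Defs "HOL-Analysis.Harmonic_Numbers"
begin

text \<open>
  Containers for sets \<open>J\<close> with \<open>card (J + J) \<le> m\<close> are found by exposing \<open>J\<close> gradually while
  maintaining \<open>A \<subseteq> J + J\<close>, \<open>S \<subseteq> J \<subseteq> B\<close>. Learning \<open>b \<in> J\<close> puts \<open>b + S\<close> into \<open>A\<close>; learning \<open>b \<notin> J\<close>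
  removes \<open>b\<close> from \<open>B\<close>. A phase selects \<open>k\<close> elements \<open>b\<close> with many sums \<open>b + x\<close>, \<open>x \<in> B\<close>, outside
  \<open>A\<close> and then processes every \<open>x\<close> with at least \<open>d\<close> sums in \<open>(x + S) - A\<close>; double counting shows that
  \<open>card B - card A\<close> drops by a fixed amount \<open>h\<close> in each phase. Positive answers are rare: the \<open>k\<close>
  selections per phase, and at most \<open>m / d\<close> absorptions in total because \<open>card A \<le> m\<close> throughout.
  So there are few containers \<open>B\<close>, each either noticeably smaller than \<open>m / 2\<close> or such that, up to
  \<open>k\<close> exceptions, every translate \<open>b + B\<close> is almost contained in a set \<open>A\<close> of size at most \<open>m\<close>.

  In the second case, reduce modulo \<open>q = Max B - Min B\<close>. Both \<open>Min B + B\<close> and \<open>Max B + B\<close> nearly lie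
  in \<open>A\<close>, so the residues \<open>U\<close> of \<open>B\<close> have a sumset that is, up to few sums, hardly larger than \<open>U\<close>.
  Then any difference of two elements of \<open>U\<close> occurs in almost \<open>card U\<close> ways, hence \<open>U - U\<close> is a
  subgroup only slightly larger than \<open>U\<close>, and \<open>B\<close> lies in a short progression. Containers of the
  first kind hold too few \<open>s\<close>-sets compared with the \<open>s\<close>-subsets of \<open>{1..K s / 2}\<close>.
\<close>

section \<open>States of the exposure process and covers of the sets they allow\<close>

definition misses :: "int set \<Rightarrow> int set \<Rightarrow> int \<Rightarrow> nat" where
  "misses A B b = card {x \<in> B. b + x \<notin> A}"

definition covers :: "int set set \<Rightarrow> nat \<Rightarrow> int set \<Rightarrow> int set \<Rightarrow> int set \<Rightarrow> bool" where
  "covers F m A B S \<longleftrightarrow>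
     (\<forall>J. A \<subseteq> sumset J J \<and> S \<subseteq> J \<and> J \<subseteq> B \<and> card (sumset J J) \<le> m \<longrightarrow> (\<exists>C\<in>F. J \<subseteq> C))"

text \<open>
  The exponent \<open>q\<close> counts the positive answers still allowed; the base accounts for the number of
  negative ones, each of which removes an element of \<open>B\<close>.
\<close>

definition covered :: "(int set \<Rightarrow> bool) \<Rightarrow> nat \<Rightarrow> int set \<Rightarrow> int set \<Rightarrow> int set \<Rightarrow> nat \<Rightarrow> bool" where
  "covered P m A B S q \<longleftrightarrow>
     (\<exists>F. finite F \<and> card F \<le> (card B + 1) ^ q \<and> (\<forall>C\<in>F. P C) \<and> covers F m A B S)"

lemma finite_sumset: "finite A \<Longrightarrow> finite B \<Longrightarrow> finite (sumset A B)"
proof -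
  have "sumset A B = (\<lambda>(a, b). a + b) ` (A \<times> B)" by (auto simp: sumset_def)
  then show "finite A \<Longrightarrow> finite B \<Longrightarrow> finite (sumset A B)" by simp
qed

lemma misses_le_remove: "finite B \<Longrightarrow> misses A B b \<le> misses A (B - {y}) b + 1"
proof -
  assume "finite B"
  then have "card {x \<in> B. b + x \<notin> A} \<le> card (insert y {x \<in> B - {y}. b + x \<notin> A})"
    by (intro card_mono) auto
  also have "\<dots> \<le> card {x \<in> B - {y}. b + x \<notin> A} + 1"
    by (simp add: card_insert_le_m1 card_insert_if \<open>finite B\<close>)
  finally show ?thesis by (simp add: misses_def)
qed

text \<open>Translation by \<open>b\<close> is injective, so each element added to \<open>A\<close>
  repairs at most one missing sum. This keeps the lower bounds on selected elements valid while
  \<open>A\<close> grows.\<close>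

lemma misses_le_extend:
  assumes "finite A'" "finite B" "A \<subseteq> A'"
  shows "misses A B b + card A \<le> misses A' B b + card A'"
proof -
  have "{x \<in> B. b + x \<notin> A} = {x \<in> B. b + x \<notin> A'} \<union> {x \<in> B. b + x \<in> A' - A}"
    using assms by auto
  then have "misses A B b \<le> misses A' B b + card {x \<in> B. b + x \<in> A' - A}"
    by (simp add: misses_def card_Un_le)
  also have "card {x \<in> B. b + x \<in> A' - A} \<le> card (A' - A)"
    by (rule card_inj_on_le[of "(+) b"]) (use assms in auto)
  also have "card (A' - A) = card A' - card A"
    using assms by (meson card_Diff_subset finite_subset)
  finally show ?thesis using card_mono[OF assms(1,3)] by linarith
qed

lemma sum_misses_swap:
  assumes "finite B" "finite S"
  shows "(\<Sum>b\<in>S. misses A B b) = (\<Sum>x\<in>B. misses A S x)"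
proof -
  have *: "misses A B b = (\<Sum>x\<in>B. if b + x \<notin> A then 1 else 0)" if "finite B" for B b
    using that by (simp add: misses_def flip: sum.inter_filter)
  show ?thesis unfolding *[OF assms(1)] *[OF assms(2)]
    by (subst sum.swap) (simp add: add.commute)
qed

lemma coversI:
  assumes "\<And>J. A \<subseteq> sumset J J \<Longrightarrow> S \<subseteq> J \<Longrightarrow> J \<subseteq> B \<Longrightarrow> card (sumset J J) \<le> m \<Longrightarrow> \<exists>C\<in>F. J \<subseteq> C"
  shows "covers F m A B S"
  unfolding covers_def by (intro allI impI assms) simp_all

lemma coversD:
  assumes "covers F m A B S" "A \<subseteq> sumset J J" "S \<subseteq> J" "J \<subseteq> B" "card (sumset J J) \<le> m"
  shows "\<exists>C\<in>F. J \<subseteq> C"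
  using assms(1)[unfolded covers_def, THEN spec, of J] assms(2-) by simp

lemma coveredI:
  assumes "finite F" "card F \<le> (card B + 1) ^ q" "\<forall>C\<in>F. P C" "covers F m A B S"
  shows "covered P m A B S q"
  unfolding covered_def using assms by (intro exI[of _ F]) simp

lemma coveredE:
  assumes "covered P m A B S q"
  obtains F where "finite F" "card F \<le> (card B + 1) ^ q" "\<forall>C\<in>F. P C" "covers F m A B S"
  using assms unfolding covered_def by (elim exE conjE) simp

lemma covered_final: "P B \<Longrightarrow> covered P m A B S q"
  by (rule coveredI[of "{B}"]) (auto intro: coversI)

lemma covered_vacuous:
  assumes "finite B" "card A > m"
  shows "covered P m A B S q"
proof (rule coveredI[of "{}"])
  show "covers {} m A B S"
  proof (rule coversI)
    fix J assume J: "A \<subseteq> sumset J J" "J \<subseteq> B" "card (sumset J J) \<le> m"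
    have "finite (sumset J J)"
      using J(2) assms(1) by (intro finite_sumset) (rule finite_subset; assumption)+
    then have "card A \<le> m" using card_mono[OF _ J(1)] J(3) by linarith
    then show "\<exists>C\<in>{}. J \<subseteq> C" using assms(2) by linarith
  qed
qed simp_all

text \<open>Forgetting exposed sums or members only enlarges the class of \<open>J\<close> to be
  covered. This permits emptying \<open>S\<close> when a phase ends.\<close>

lemma covered_weaken:
  assumes "covered P m A' B S' q'" "A' \<subseteq> A" "S' \<subseteq> S" "q' \<le> q"
  shows "covered P m A B S q"
proof -
  from assms(1) obtain F where F: "finite F" "card F \<le> (card B + 1) ^ q'" "\<forall>C\<in>F. P C"
    "covers F m A' B S'"
    by (rule coveredE)
  show ?thesis
  proof (rule coveredI[OF F(1) _ F(3)])
    show "card F \<le> (card B + 1) ^ q"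
      using F(2) power_increasing[OF assms(4), of "card B + 1"] by linarith
    show "covers F m A B S"
    proof (rule coversI)
      fix J assume "A \<subseteq> sumset J J" "S \<subseteq> J" "J \<subseteq> B" "card (sumset J J) \<le> m"
      with assms(2,3) show "\<exists>C\<in>F. J \<subseteq> C" by (intro coversD[OF F(4)]) simp_all
    qed
  qed
qed

text \<open>One question about \<open>b\<close>. With \<open>N = card B\<close>, the two families
  together number at most \<open>(N + 1) ^ q + N * N ^ q \<le> (N + 1) ^ Suc q\<close>: a negative
  answer keeps the exponent but lowers the base.\<close>

lemma covered_branch:
  assumes "finite B" "b \<in> B"
    and yes: "covered P m (A \<union> (+) b ` S) B (insert b S) q"
    and no: "b \<notin> S \<Longrightarrow> covered P m A (B - {b}) S (Suc q)"
  shows "covered P m A B S (Suc q)"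
proof -
  have cB: "card (B - {b}) + 1 = card B"
    using card_Suc_Diff1[OF assms(1,2)] by simp
  from yes obtain F where F: "finite F" "card F \<le> (card B + 1) ^ q" "\<forall>C\<in>F. P C"
    "covers F m (A \<union> (+) b ` S) B (insert b S)"
    by (rule coveredE)
  have "\<exists>G. finite G \<and> card G \<le> card B ^ Suc q \<and> (\<forall>C\<in>G. P C) \<and> covers G m A (B - {b}) S"
  proof (cases "b \<in> S")
    case True
    then have "covers {} m A (B - {b}) S" by (intro coversI) blast
    then show ?thesis by (intro exI[of _ "{}"]) simp
  next
    case False
    from no[OF this] show ?thesis unfolding covered_def cB .
  qed
  then obtain G where G: "finite G" "card G \<le> card B ^ Suc q" "\<forall>C\<in>G. P C"
    "covers G m A (B - {b}) S"
    by (elim exE conjE)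
  show ?thesis
  proof (rule coveredI[of "F \<union> G"])
    have "card (F \<union> G) \<le> card F + card G" by (rule card_Un_le)
    also have "\<dots> \<le> (card B + 1) ^ q + card B * card B ^ q" using F(2) G(2) by simp
    also have "\<dots> \<le> (card B + 1) ^ q + card B * (card B + 1) ^ q"
      by (intro add_left_mono mult_left_mono power_mono) simp_all
    also have "\<dots> = (card B + 1) ^ Suc q" by (simp add: algebra_simps)
    finally show "card (F \<union> G) \<le> (card B + 1) ^ Suc q" .
    show "covers (F \<union> G) m A B S"
    proof (rule coversI)
      fix J assume J: "A \<subseteq> sumset J J" "S \<subseteq> J" "J \<subseteq> B" "card (sumset J J) \<le> m"
      show "\<exists>C\<in>F \<union> G. J \<subseteq> C"
      proof (cases "b \<in> J")
        case True
        have "(+) b ` S \<subseteq> sumset J J" using True J(2) by (auto simp: sumset_def)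
        then have "\<exists>C\<in>F. J \<subseteq> C" using J True by (intro coversD[OF F(4)]) simp_all
        then show ?thesis by blast
      next
        case False
        then have "\<exists>C\<in>G. J \<subseteq> C" using J by (intro coversD[OF G(4)]) blast+
        then show ?thesis by blast
      qed
    qed
  qed (use F(1,3) G(1,3) in auto)
qed

section \<open>Selection phases and absorption\<close>

text \<open>The state in which a phase can select nothing more: \<open>S\<close> holds the elements
  selected so far, and no other \<open>b\<close> has \<open>t\<close> missing sums.\<close>

definition nearly_closed :: "nat \<Rightarrow> nat \<Rightarrow> real \<Rightarrow> int set \<Rightarrow> bool" where
  "nearly_closed m k t B \<longleftrightarrow>
     (\<exists>A S. finite A \<and> card A \<le> m \<and> S \<subseteq> B \<and> card S \<le> k \<and>
        (\<forall>b\<in>B - S. real (misses A B b) < t))"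

lemma div_drop:
  fixes d :: nat
  assumes "0 < d" "a + d \<le> a'" "a' \<le> m"
  shows "Suc ((m - a') div d) \<le> (m - a) div d"
proof -
  have "Suc ((m - a') div d) = (m - a' + d) div d" using assms(1) by simp
  also have "\<dots> \<le> (m - a) div d" using assms by (intro div_le_mono) linarith
  finally show ?thesis .
qed

lemma card_extend:
  assumes "finite A" "finite S"
  shows "card (A \<union> (+) b ` S) = card A + misses A S b"
proof -
  have "A \<union> (+) b ` S = A \<union> (+) b ` {x \<in> S. b + x \<notin> A}" by auto
  also have "card \<dots> = card A + card ((+) b ` {x \<in> S. b + x \<notin> A})"
    using assms by (intro card_Un_disjoint) auto
  also have "card ((+) b ` {x \<in> S. b + x \<notin> A}) = misses A S b"
    unfolding misses_def by (intro card_image) auto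
  finally show ?thesis .
qed

text \<open>A positive answer enlarges \<open>A\<close> by at least \<open>d\<close>, which lowers
  \<open>(m - card A) div d\<close> unless \<open>A\<close> outgrows \<open>m\<close>. The
  \<open>Suc\<close> pays for that last answer, after which nothing is left to cover.\<close>

lemma covered_absorb:
  assumes "finite A" "card A \<le> m" "finite B" "finite S" "b \<in> B" "0 < d" "d \<le> misses A S b"
    and yes: "card (A \<union> (+) b ` S) \<le> m \<Longrightarrow>
      covered P m (A \<union> (+) b ` S) B S (u + Suc ((m - card (A \<union> (+) b ` S)) div d))"
    and no: "b \<notin> S \<Longrightarrow> covered P m A (B - {b}) S (u + Suc ((m - card A) div d))"
  shows "covered P m A B S (u + Suc ((m - card A) div d))"
proof -
  let ?A = "A \<union> (+) b ` S"
  have "covered P m ?A B (insert b S) (u + (m - card A) div d)"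
  proof (cases "card ?A \<le> m")
    case True
    have "Suc ((m - card ?A) div d) \<le> (m - card A) div d"
      using assms card_extend[of A S b] True by (intro div_drop) auto
    then show ?thesis by (intro covered_weaken[OF yes[OF True]]) auto
  next
    case False
    then show ?thesis using assms(3) by (intro covered_vacuous) auto
  qed
  then show ?thesis
    unfolding add_Suc_right by (rule covered_branch[OF assms(3,5)]) (fact no[unfolded add_Suc_right])
qed

text \<open>
  \<open>D\<close> is the value of \<open>card B - card A\<close> at the start of the current phase. A single step changes
  this difference by at least as much as any of the counts \<open>misses A B b\<close>, so the lower bound
  imposed when \<open>b\<close> was selected persists in the stated form.
\<close>

lemma covered_phases:
  fixes m k d r :: nat and h \<beta> D :: real
  assumes "0 < d" "0 < k" "0 < h"
    and dk: "real d * (2 * real m) \<le> real k * h"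
    and P: "\<And>B. finite B \<Longrightarrow> real (card B) \<le> \<beta> \<Longrightarrow> P B" "\<And>B. finite B \<Longrightarrow> nearly_closed m k (2 * h) B \<Longrightarrow> P B"
  shows "finite A \<Longrightarrow> card A \<le> m \<Longrightarrow> finite B \<Longrightarrow> card B \<le> 2 * m \<Longrightarrow> S \<subseteq> B \<Longrightarrow> card S \<le> k \<Longrightarrow>
    \<forall>b\<in>S. real (misses A B b) \<ge> 2 * h - D + (real (card B) - real (card A)) \<Longrightarrow>
    real (card B) - real (card A) \<le> D \<Longrightarrow> D \<le> \<beta> - real m + real r * h \<Longrightarrow>
    covered P m A B S (r * k + (k - card S) + Suc ((m - card A) div d))"
\<comment> \<open>Positive answers lower the exponent, negative ones lower \<open>card B\<close>.
  Closing a phase trades \<open>Suc r' * k + 0\<close> for \<open>r' * k + k\<close>, an equal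
  exponent, so the extra summand \<open>r\<close> provides the decrease.\<close>
proof (induction "r * k + (k - card S) + Suc ((m - card A) div d) + card B + r"
    arbitrary: A B S D r rule: less_induct)
  case less
  note fA = less.prems(1) and Am = less.prems(2) and fB = less.prems(3) and Bm = less.prems(4)
    and SB = less.prems(5) and Sk = less.prems(6) and deg = less.prems(7) and D = less.prems(8,9)
  have fS: "finite S" using SB fB finite_subset by blast
  let ?q = "r * k + (k - card S) + Suc ((m - card A) div d)"
  have no: "covered P m A (B - {b}) S ?q" if b: "b \<in> B" "b \<notin> S" for b
  proof (rule less.hyps)
    have c: "card (B - {b}) = card B - 1" "card B > 0"
      using b fB by (auto simp: card_gt_0_iff)
    then show "?q + card (B - {b}) + r < ?q + card B + r" by simp
    show "card (B - {b}) \<le> 2 * m" using c Bm by simp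
    show "\<forall>x\<in>S. real (misses A (B - {b}) x) \<ge> 2 * h - D + (real (card (B - {b})) - real (card A))"
    proof
      fix x assume "x \<in> S"
      with deg have "real (misses A B x) \<ge> 2 * h - D + (real (card B) - real (card A))" by blast
      moreover have "real (misses A B x) \<le> real (misses A (B - {b}) x) + 1"
        using misses_le_remove[OF fB, of A x b] by linarith
      moreover have "real (card (B - {b})) = real (card B) - 1" using c by (simp add: of_nat_diff)
      ultimately show "real (misses A (B - {b}) x) \<ge> 2 * h - D + (real (card (B - {b})) - real (card A))"
        by linarith
    qed
    show "real (card (B - {b})) - real (card A) \<le> D" using D(1) c by simp
  qed (use fA fB Am SB Sk b D in auto)
  consider (small) "real (card B) \<le> \<beta>"
    | (absorb) b where "b \<in> B" "d \<le> misses A S b"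
    | (select) b where "card S < k" "b \<in> B - S" "real (misses A B b) \<ge> 2 * h"
    | (closed) "card S < k" "\<forall>b\<in>B - S. real (misses A B b) < 2 * h"
    | (reset) "card S = k" "\<forall>b\<in>B. misses A S b < d" "real (card B) > \<beta>"
    using Sk by (fastforce simp: not_le)
  then show ?case
  proof cases
    case small
    then show ?thesis using P(1)[OF fB] by (intro covered_final)
  next
    case absorb
    let ?A = "A \<union> (+) b ` S"
    show ?thesis
    proof (rule covered_absorb[OF fA Am fB fS absorb(1) assms(1) absorb(2)])
      assume le: "card ?A \<le> m"
      show "covered P m ?A B S (r * k + (k - card S) + Suc ((m - card ?A) div d))"
      proof (rule less.hyps[where D = D])
        have cA: "card ?A = card A + misses A S b" by (rule card_extend[OF fA fS])
        show "r * k + (k - card S) + Suc ((m - card ?A) div d) + card B + r < ?q + card B + r"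
          using div_drop[OF assms(1) _ le, of "card A"] cA absorb(2) by simp
        show "\<forall>x\<in>S. real (misses ?A B x) \<ge> 2 * h - D + (real (card B) - real (card ?A))"
        proof
          fix x assume "x \<in> S"
          with deg have "real (misses A B x) \<ge> 2 * h - D + (real (card B) - real (card A))" by blast
          moreover have "misses A B x + card A \<le> misses ?A B x + card ?A"
            using fA fS fB by (intro misses_le_extend) auto
          ultimately show "real (misses ?A B x) \<ge> 2 * h - D + (real (card B) - real (card ?A))"
            by linarith
        qed
        show "real (card B) - real (card ?A) \<le> D" using D(1) cA by simp
      qed (use fA fS fB le Bm SB Sk D in auto)
    qed (use no absorb in auto)
  next
    case select
    define q where "q = r * k + (k - card (insert b S)) + Suc ((m - card A) div d)"
    have q: "?q = Suc q" using select fS by (auto simp: q_def)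
    have "covered P m A B (insert b S) q"
      unfolding q_def
    proof (rule less.hyps[where D = D])
      show "r * k + (k - card (insert b S)) + Suc ((m - card A) div d) + card B + r < ?q + card B + r"
        using q unfolding q_def by linarith
      show "\<forall>x\<in>insert b S. real (misses A B x) \<ge> 2 * h - D + (real (card B) - real (card A))"
        using deg select(3) D(1) by auto
      show "insert b S \<subseteq> B" "card (insert b S) \<le> k" using SB select fS by auto
    qed (fact fA Am fB Bm D)+
    then have "covered P m (A \<union> (+) b ` S) B (insert b S) q"
      by (rule covered_weaken) auto
    moreover have "b \<in> B" using select by blast
    moreover have "covered P m A (B - {b}) S (Suc q)"
      unfolding q[symmetric] by (rule no) (use select in blast)+
    ultimately show ?thesis unfolding q by (intro covered_branch[OF fB])
  next
    case closed
    then have "nearly_closed m k (2 * h) B"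
      unfolding nearly_closed_def using fA Am SB by (intro exI[of _ A] exI[of _ S]) auto
    then show ?thesis using P(2)[OF fB] by (intro covered_final)
  next
    case reset
    let ?D = "real (card B) - real (card A)"
    \<comment> \<open>Double counting of missing sums between \<open>S\<close> and \<open>B\<close>:
      each of the \<open>k\<close> selected elements has at least \<open>2 * h - D + ?D\<close>,
      each element of \<open>B\<close> fewer than \<open>d\<close>. With \<open>dk\<close> this
      forces \<open>?D \<le> D - h\<close>.\<close>
    have "real k * (2 * h - D + ?D) \<le> (\<Sum>b\<in>S. real (misses A B b))"
      using sum_mono[of S "\<lambda>_. 2 * h - D + ?D"] deg reset(1) by simp
    also have "\<dots> = (\<Sum>x\<in>B. real (misses A S x))"
      using sum_misses_swap[OF fB fS, of A] by (metis of_nat_sum)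
    also have "\<dots> \<le> (\<Sum>x\<in>B. real d)"
      using reset(2) by (intro sum_mono) (simp add: less_imp_le)
    also have "\<dots> = real d * real (card B)" by simp
    also have "\<dots> \<le> real d * (2 * real m)" using Bm by (intro mult_left_mono) linarith+
    also note dk
    finally have "2 * h - D + ?D \<le> h" using assms(2) by simp
    then have drop: "?D \<le> D - h" by simp
    moreover have "?D > \<beta> - real m" using reset(3) Am by linarith
    \<comment> \<open>With no phase left, \<open>D \<le> \<beta> - m\<close> would contradict
      \<open>card B > \<beta>\<close> and \<open>card A \<le> m\<close>.\<close>
    ultimately have "r \<noteq> 0" using D(2) assms(3) by (cases r) auto
    then obtain r' where r: "r = Suc r'" using not0_implies_Suc by blast
    have "covered P m A B {} (r' * k + (k - card ({}::int set)) + Suc ((m - card A) div d))"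
    proof (rule less.hyps[where D = ?D])
      show "?D \<le> \<beta> - real m + real r' * h"
        using drop D(2) r by (simp add: algebra_simps)
    qed (use fA fB Am Bm reset r in auto)
    then show ?thesis by (rule covered_weaken) (auto simp: r)
  qed
qed

text \<open>One extra phase reaches the bound \<open>card B \<le> 2 * m\<close> that
  \<open>covered_phases\<close> needs. While \<open>B\<close> is larger, any element may be
  selected, since every translate of \<open>B\<close> has at least \<open>card B - card A\<close>
  sums outside \<open>A\<close>.\<close>

lemma covered_start:
  fixes m k d r :: nat and h \<beta> :: real
  assumes "0 < d" "2 * d \<le> k" "k \<le> 2 * m" "0 < h"
    and dk: "real d * (2 * real m) \<le> real k * h"
    and P: "\<And>B. finite B \<Longrightarrow> real (card B) \<le> \<beta> \<Longrightarrow> P B" "\<And>B. finite B \<Longrightarrow> nearly_closed m k (2 * h) B \<Longrightarrow> P B"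
    and r: "3 * real m \<le> \<beta> + real r * h"
  shows "finite A \<Longrightarrow> card A \<le> m \<Longrightarrow> finite B \<Longrightarrow> S \<subseteq> B \<Longrightarrow> card S \<le> k \<Longrightarrow>
    covered P m A B S (Suc r * k + (k - card S) + Suc ((m - card A) div d))"
proof (induction "Suc r * k + (k - card S) + Suc ((m - card A) div d) + card B"
    arbitrary: A B S rule: less_induct)
  case less
  note fA = less.prems(1) and Am = less.prems(2) and fB = less.prems(3)
    and SB = less.prems(4) and Sk = less.prems(5)
  have fS: "finite S" using SB fB finite_subset by blast
  let ?q = "Suc r * k + (k - card S) + Suc ((m - card A) div d)"
  have no: "covered P m A (B - {b}) S ?q" if b: "b \<in> B" "b \<notin> S" for b
  proof (rule less.hyps)
    have c: "card (B - {b}) = card B - 1" "card B > 0"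
      using b fB by (auto simp: card_gt_0_iff)
    then show "?q + card (B - {b}) < ?q + card B" by simp
  qed (use fA fB Am SB Sk b in auto)
  have ex: "\<exists>b. b \<in> B - S" if "card S < k" "card B > 2 * m"
  proof (rule ccontr)
    assume "\<not> ?thesis"
    then have "B \<subseteq> S" by blast
    then have "card B \<le> card S" by (rule card_mono[OF fS])
    then show False using that assms(3) by linarith
  qed
  consider (small) "card B \<le> 2 * m"
    | (absorb) b where "b \<in> B" "d \<le> misses A S b"
    | (select) b where "card S < k" "b \<in> B - S"
    | (reset) "card S = k" "\<forall>b\<in>B. misses A S b < d" "card B > 2 * m"
    using Sk ex by (fastforce simp: not_le)
  then show ?case
  proof cases
    case small
    have "covered P m A B {} (r * k + (k - card ({}::int set)) + Suc ((m - card A) div d))"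
      by (rule covered_phases[where h = h and \<beta> = \<beta> and D = "real (card B) - real (card A)"])
        (use assms fA Am fB small in auto)
    then show ?thesis by (rule covered_weaken) auto
  next
    case absorb
    let ?A = "A \<union> (+) b ` S"
    show ?thesis
    proof (rule covered_absorb[OF fA Am fB fS absorb(1) assms(1) absorb(2)])
      assume le: "card ?A \<le> m"
      show "covered P m ?A B S (Suc r * k + (k - card S) + Suc ((m - card ?A) div d))"
      proof (rule less.hyps)
        have cA: "card ?A = card A + misses A S b" by (rule card_extend[OF fA fS])
        show "Suc r * k + (k - card S) + Suc ((m - card ?A) div d) + card B < ?q + card B"
          using div_drop[OF assms(1) _ le, of "card A"] cA absorb(2) by simp
      qed (use fA fS fB le SB Sk in auto)
    qed (use no absorb in auto)
  next
    case select
    define q where "q = Suc r * k + (k - card (insert b S)) + Suc ((m - card A) div d)"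
    have q: "?q = Suc q" using select fS by (auto simp: q_def)
    have "covered P m A B (insert b S) q"
      unfolding q_def
    proof (rule less.hyps)
      show "Suc r * k + (k - card (insert b S)) + Suc ((m - card A) div d) + card B < ?q + card B"
        using q unfolding q_def by linarith
    qed (use fA fS fB Am SB select in auto)
    then have "covered P m (A \<union> (+) b ` S) B (insert b S) q"
      by (rule covered_weaken) auto
    moreover have "b \<in> B" using select by blast
    moreover have "covered P m A (B - {b}) S (Suc q)"
      unfolding q[symmetric] by (rule no) (use select in blast)+
    ultimately show ?thesis unfolding q by (intro covered_branch[OF fB])
  next
    case reset
    \<comment> \<open>After \<open>k\<close> selections with no absorption possible, double counting
      gives \<open>k * card B \<le> card B * (d - 1) + k * card A\<close>. As
      \<open>2 * d \<le> k\<close>, this yields \<open>card B \<le> 2 * m\<close>, so the case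
      cannot occur.\<close>
    have hit: "misses A B b + card A \<ge> card B" for b
      using misses_le_extend[OF fA fB, of "{}" b] by (simp add: misses_def)
    have "k * card B = (\<Sum>b\<in>S. card B)" using reset(1) by simp
    also have "\<dots> \<le> (\<Sum>b\<in>S. misses A B b + card A)" by (intro sum_mono hit)
    also have "\<dots> = (\<Sum>x\<in>B. misses A S x) + k * card A"
      using reset(1) sum_misses_swap[OF fB fS, of A] by (simp add: sum.distrib)
    also have "(\<Sum>x\<in>B. misses A S x) \<le> card B * (d - 1)"
      using reset(2) sum_bounded_above[of B "misses A S" "d - 1"] by fastforce
    finally have le: "k * card B \<le> card B * (d - 1) + k * card A" by simp
    have "2 * (card B * (d - 1)) \<le> card B * k"
      using assms(2) by (metis diff_le_self le_trans mult.left_commute mult_le_mono2)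
    then have "card B * k \<le> 2 * (k * card A)" using le mult.commute[of k "card B"] by linarith
    moreover have "2 * (k * card A) \<le> k * (2 * m)" using Am by simp
    moreover have "k * (2 * m) < k * card B" using reset(3) assms(1,2) by simp
    ultimately show ?thesis by (simp add: mult.commute)
  qed
qed

section \<open>Almost closed sets, residues and progressions\<close>

lemma int_subgroup_multiples:
  fixes D :: "int set"
  assumes diff: "\<And>x y. x \<in> D \<Longrightarrow> y \<in> D \<Longrightarrow> x - y \<in> D" and q: "q \<in> D" "0 < q"
  obtains g where "0 < g" "\<And>h. h \<in> D \<longleftrightarrow> g dvd h"
proof -
  have zero: "0 \<in> D" using diff[OF q(1) q(1)] by simp
  have neg: "- x \<in> D" if "x \<in> D" for x using diff[OF zero that] by simp
  have add: "x + y \<in> D" if "x \<in> D" "y \<in> D" for x y using diff[OF that(1) neg[OF that(2)]] by simp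
  have mult_nat: "int n * x \<in> D" if "x \<in> D" for n x
    by (induction n) (use zero add that in \<open>auto simp: algebra_simps\<close>)
  have mult: "i * x \<in> D" if "x \<in> D" for i x
    using mult_nat[OF that, of "nat i"] neg[OF mult_nat[OF that, of "nat (- i)"]]
    by (cases "i \<ge> 0") auto
  define g where "g = int (LEAST n. 0 < n \<and> int n \<in> D)"
  have "0 < nat q \<and> int (nat q) \<in> D" using q by simp
  from LeastI[of "\<lambda>n. 0 < n \<and> int n \<in> D", OF this]
  have g: "0 < g" "g \<in> D" by (auto simp: g_def)
  have least: "g \<le> x" if "0 < x" "x \<in> D" for x
    using Least_le[of "\<lambda>n. 0 < n \<and> int n \<in> D" "nat x"] that by (simp add: g_def)
  have "g dvd h" if "h \<in> D" for h
  proof -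
    have "h mod g = h - (h div g) * g" by (simp add: minus_div_mult_eq_mod)
    then have "h mod g \<in> D" using diff[OF that mult[OF g(2)]] by simp
    then have "h mod g = 0" using least[of "h mod g"] g(1) pos_mod_bound[of g h] pos_mod_sign[of g h]
      by linarith
    then show ?thesis by (simp add: dvd_eq_mod_eq_0)
  qed
  moreover have "h \<in> D" if "g dvd h" for h
    using that mult[OF g(2)] by (auto simp: dvd_def mult.commute)
  ultimately show ?thesis using that g(1) by blast
qed

lemma card_inter_ge:
  fixes X Y Z :: "'a set"
  assumes "finite Z" "X \<subseteq> Z" "Y \<subseteq> Z"
  shows "card X + card Y \<le> card (X \<inter> Y) + card Z"
proof -
  have "finite X" "finite Y" using assms finite_subset by blast+
  then have "card X + card Y = card (X \<union> Y) + card (X \<inter> Y)" by (rule card_Un_Int)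
  also have "card (X \<union> Y) \<le> card Z" using assms by (intro card_mono) auto
  finally show ?thesis by simp
qed

lemma mod_eq_imp_eq:
  fixes x y q :: int
  assumes "x mod q = y mod q" "0 \<le> x" "x < q" "0 \<le> y" "y < q"
  shows "x = y"
  using assms by simp

text \<open>Two subsets of \<open>U\<close> of size above \<open>card U / 2\<close> must meet, so a
  difference of two differences is again a difference: modulo \<open>q\<close>, \<open>U - U\<close>
  is a subgroup. Its order is bounded by counting representations inside
  \<open>U \<times> U\<close>.\<close>

lemma popular_differences:
  fixes U :: "int set" and \<rho> :: real
  assumes U: "U \<subseteq> {0..<q}" "0 \<in> U"
    and pop: "\<And>x y. x \<in> U \<Longrightarrow> y \<in> U \<Longrightarrow> real (card U) - \<rho> \<le> real (card {u \<in> U. (u - (x - y)) mod q \<in> U})"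
    and \<rho>: "2 * \<rho> < real (card U)"
  obtains g where "0 < g" "g dvd q" "\<And>u. u \<in> U \<Longrightarrow> g dvd u"
    "real_of_int (q div g) * (real (card U) - \<rho>) \<le> real (card U) ^ 2"
proof -
  \<comment> \<open>\<open>D\<close> is the \<open>q\<close>-periodic lift of \<open>U - U\<close>
    to the integers; \<open>X h\<close> collects the minuends of the representations of
    \<open>h\<close>.\<close>
  define D where "D = {h. \<exists>x\<in>U. \<exists>y\<in>U. (x - y) mod q = h mod q}"
  define X where "X h = {u \<in> U. (u - h) mod q \<in> U}" for h
  have q: "0 < q" using U by auto
  have fU: "finite U" using U(1) finite_subset by blast
  have X: "real (card U) - \<rho> \<le> real (card (X h))" if "h \<in> D" for h
  proof -
    obtain x y where xy: "x \<in> U" "y \<in> U" "(x - y) mod q = h mod q" using \<open>h \<in> D\<close> D_def by blast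
    have "(u - (x - y)) mod q = (u - h) mod q" for u using xy(3) by (rule mod_diff_cong[OF refl])
    then show ?thesis using pop[OF xy(1,2)] by (simp add: X_def)
  qed
  have "h - h' \<in> D" if h: "h \<in> D" "h' \<in> D" for h h'
  proof -
    have "card (X h) + card (X h') \<le> card (X h \<inter> X h') + card U"
      using fU by (intro card_inter_ge) (auto simp: X_def)
    then have "card (X h \<inter> X h') > 0" using X[OF h(1)] X[OF h(2)] \<rho> by linarith
    then obtain u where "u \<in> X h" "u \<in> X h'" by (metis card.empty disjoint_iff less_irrefl)
    then have u: "(u - h) mod q \<in> U" "(u - h') mod q \<in> U" by (auto simp: X_def)
    have "((u - h') mod q - (u - h) mod q) mod q = (h - h') mod q"
      by (simp add: mod_diff_eq)
    then show ?thesis using u unfolding D_def by blast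
  qed
  moreover have UD: "U \<subseteq> D" using U(2) unfolding D_def by force
  moreover have qD: "q \<in> D" using U(2) unfolding D_def by force
  ultimately obtain g where g: "0 < g" "\<And>h. h \<in> D \<longleftrightarrow> g dvd h"
    using int_subgroup_multiples[of D q] q by blast
  have gq: "g dvd q" using g(2) qD by simp
  define H where "H = (\<lambda>i. i * g) ` {0..<q div g}"
  have cH: "card H = nat (q div g)"
    unfolding H_def using g(1) by (subst card_image) (auto simp: inj_on_def)
  have HD: "h \<in> D \<and> 0 \<le> h \<and> h < q" if hH: "h \<in> H" for h
  proof -
    obtain i where i: "h = i * g" "0 \<le> i" "i < q div g" using hH unfolding H_def by fastforce
    then have "i * g < q div g * g" using g(1) by simp
    then show ?thesis using i g gq by simp
  qed
  have inj: "inj_on (\<lambda>(h, u). (u, (u - h) mod q)) (Sigma H X)"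
  proof (rule inj_onI, clarsimp)
    fix h h' u assume *: "h \<in> H" "h' \<in> H" "(u - h) mod q = (u - h') mod q"
    then have "(u - (u - h) mod q) mod q = (u - (u - h') mod q) mod q" by simp
    then have "h mod q = h' mod q" by (simp add: mod_diff_right_eq)
    then show "h = h'" using HD[OF *(1)] HD[OF *(2)] by (intro mod_eq_imp_eq[of h q h']) auto
  qed
  have fin: "finite H" "\<And>h. finite (X h)" using fU by (auto simp: H_def X_def)
  have "real (card H) * (real (card U) - \<rho>) = (\<Sum>h\<in>H. real (card U) - \<rho>)" by simp
  also have "\<dots> \<le> (\<Sum>h\<in>H. real (card (X h)))" using HD X by (intro sum_mono) blast
  also have "\<dots> = real (card (Sigma H X))" using fin by (simp add: card_SigmaI)
  also have "card (Sigma H X) \<le> card (U \<times> U)"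
    using inj by (rule card_inj_on_le) (use fU in \<open>auto simp: X_def\<close>)
  also have "card (U \<times> U) = card U ^ 2" by (simp add: card_cartesian_product power2_eq_square)
  finally have "real (card H) * (real (card U) - \<rho>) \<le> real (card U) ^ 2" by simp
  then have "real_of_int (q div g) * (real (card U) - \<rho>) \<le> real (card U) ^ 2"
    using cH g(1) q by (simp add: pos_imp_zdiv_nonneg_iff)
  then show ?thesis using that[of g] g gq UD by blast
qed

text \<open>Since \<open>Min B\<close> and \<open>Max B\<close> agree modulo \<open>q\<close>,
  almost every residue of \<open>U\<close>, suitably shifted, is hit by two elements of
  \<open>A\<close>; so \<open>A\<close> has at most about \<open>card A - card U\<close> residues.
  Almost all of each translate \<open>x + U\<close> lies among these, which makes differences
  popular.\<close>

lemma almost_closed_in_progression: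
  fixes A B :: "int set" and t \<rho> :: real
  assumes "finite A" "finite B" "2 \<le> card B"
    and miss: "\<And>b. b \<in> B \<Longrightarrow> real (misses A B b) \<le> t"
    and \<rho>: "\<rho> = real (card A) - 2 * real (card B) + 4 * t + 2" "2 * \<rho> < real (card B) - 1"
  shows "2 * real (card B) \<le> real (card A) + 3 * t + 2"
    and "\<exists>a g l. B \<subseteq> arith_prog a g l \<and>
      (real l - 1) * (real (card B) - 1 - \<rho>) \<le> (real (card B) - 1) ^ 2"
proof -
  define a q where "a = Min B" and "q = Max B - Min B"
  have neB: "B \<noteq> {}" using assms(3) by auto
  have aB: "a \<in> B" "a + q \<in> B" using Min_in Max_in assms(2) neB by (auto simp: a_def q_def)
  have range: "a \<le> b \<and> b \<le> a + q" if "b \<in> B" for b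
    using that assms(2) by (simp add: a_def q_def)
  have q: "0 < q"
  proof (rule ccontr)
    assume "\<not> 0 < q"
    then have "B \<subseteq> {a}" using range by fastforce
    then have "card B \<le> 1" using card_mono[of "{a}" B] by simp
    then show False using assms(3) by simp
  qed
  \<comment> \<open>\<open>a + q\<close> is left out because it has the residue of \<open>a\<close>;
    hence \<open>card B - 1\<close> in the statement.\<close>
  define U where "U = {x. x + a \<in> B \<and> x < q}"
  have B_eq: "B = insert (a + q) ((+) a ` U)"
  proof
    show "B \<subseteq> insert (a + q) ((+) a ` U)"
    proof
      fix b assume b: "b \<in> B"
      then have "b = a + q \<or> b - a \<in> U" using range[OF b] by (auto simp: U_def)
      then show "b \<in> insert (a + q) ((+) a ` U)" by (auto simp: image_iff intro: bexI[of _ "b - a"])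
    qed
  qed (use aB in \<open>auto simp: U_def add.commute\<close>)
  have U: "U \<subseteq> {0..<q}" "0 \<in> U" using range aB q by (fastforce simp: U_def)+
  have fU: "finite U" using U(1) finite_subset by blast
  have "a + q \<notin> (+) a ` U" by (auto simp: U_def)
  then have cU: "card B = card U + 1" using fU by (subst B_eq) (simp add: card_image)
  have miss_U: "real (card {u \<in> U. x + u + 2 * a \<notin> A}) \<le> t" if "x + a \<in> B" for x
  proof -
    have "card {u \<in> U. x + u + 2 * a \<notin> A} \<le> misses A B (x + a)"
      unfolding misses_def
      by (rule card_inj_on_le[of "(+) a"]) (use assms(2) in \<open>auto simp: U_def algebra_simps\<close>)
    then show ?thesis using miss[OF that] by linarith
  qed
  define C where "C = (\<lambda>z. (z - 2 * a) mod q) ` A"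
  define G where "G = {x \<in> U. x + 2 * a \<in> A \<and> x + q + 2 * a \<in> A}"
  have fin: "finite C" "finite G" using assms(1) fU by (auto simp: C_def G_def)
  have G: "real (card U) - 2 * t \<le> real (card G)"
  proof -
    have "U \<subseteq> G \<union> ({u \<in> U. 0 + u + 2 * a \<notin> A} \<union> {u \<in> U. q + u + 2 * a \<notin> A})"
      by (auto simp: G_def add.commute)
    then have "card U \<le> card (G \<union> ({u \<in> U. 0 + u + 2 * a \<notin> A} \<union> {u \<in> U. q + u + 2 * a \<notin> A}))"
      using fU fin by (intro card_mono) auto
    also have "\<dots> \<le> card G + (card {u \<in> U. 0 + u + 2 * a \<notin> A} + card {u \<in> U. q + u + 2 * a \<notin> A})"
      by (rule order_trans[OF card_Un_le add_left_mono[OF card_Un_le]])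
    finally show ?thesis using miss_U[of 0] miss_U[of q] aB by (simp add: add.commute)
  qed
  have C: "card C + card G \<le> card A"
  proof -
    let ?R = "(\<lambda>x. x + q + 2 * a) ` G"
    have "C \<subseteq> (\<lambda>z. (z - 2 * a) mod q) ` (A - ?R)"
    proof
      fix c assume "c \<in> C"
      then obtain z where z: "z \<in> A" "c = (z - 2 * a) mod q" by (auto simp: C_def)
      show "c \<in> (\<lambda>z. (z - 2 * a) mod q) ` (A - ?R)"
      proof (cases "z \<in> ?R")
        case True
        then obtain x where x: "x \<in> G" "z = x + q + 2 * a" by blast
        have "x < q" using x(1) by (simp add: G_def U_def)
        moreover have "0 \<le> x'" if "x' \<in> G" for x' using that U(1) by (auto simp: G_def)
        ultimately have "x + 2 * a \<notin> ?R" by force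
        then have "x + 2 * a \<in> A - ?R" using x(1) by (simp add: G_def)
        moreover have "c = (x + 2 * a - 2 * a) mod q" using z(2) x(2) by simp
        ultimately show ?thesis by blast
      qed (use z in blast)
    qed
    then have "card C \<le> card (A - ?R)"
      using assms(1) by (meson card_image_le card_mono finite_Diff finite_imageI le_trans)
    also have "\<dots> = card A - card ?R"
      using fin by (intro card_Diff_subset) (auto simp: G_def)
    also have "card ?R = card G" by (rule card_image) (auto simp: inj_on_def)
    finally have "card C \<le> card A - card G" .
    moreover have "card G \<le> card A"
      using assms(1) by (intro card_inj_on_le[of "\<lambda>x. x + 2 * a"]) (auto simp: G_def inj_on_def)
    ultimately show ?thesis by linarith
  qed
  define V where "V x = (\<lambda>u. (x + u) mod q) ` U \<inter> C" for x
  have V: "real (card U) - t \<le> real (card (V x))" if "x \<in> U" for x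
  proof -
    let ?W = "{u \<in> U. (x + u) + 2 * a \<in> A}"
    have inj: "inj_on (\<lambda>u. (x + u) mod q) ?W"
    proof (rule inj_onI)
      fix u v assume *: "u \<in> ?W" "v \<in> ?W" "(x + u) mod q = (x + v) mod q"
      from *(3) have "((x + u) mod q - x) mod q = ((x + v) mod q - x) mod q" by simp
      then have "u mod q = v mod q" by (simp add: mod_diff_left_eq)
      then show "u = v" using *(1,2) U(1) by (intro mod_eq_imp_eq[of u q v]) auto
    qed
    have "(x + u) mod q \<in> C" if "x + u + 2 * a \<in> A" for u
      unfolding C_def by (rule image_eqI[OF _ that]) simp
    then have "card ?W \<le> card (V x)"
      using inj fin by (intro card_inj_on_le[OF inj]) (auto simp: V_def)
    moreover have "card U = card ?W + card {u \<in> U. x + u + 2 * a \<notin> A}"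
      using fU by (subst card_Un_disjoint[symmetric]) (auto intro: arg_cong[where f = card])
    ultimately show ?thesis using miss_U[of x] that by (auto simp: U_def)
  qed
  have "card (V 0) \<le> card C" using fin by (intro card_mono) (auto simp: V_def)
  then show "2 * real (card B) \<le> real (card A) + 3 * t + 2"
    using V[OF U(2)] C G cU by simp
  \<comment> \<open>Inclusion-exclusion in \<open>C\<close> gives
    \<open>card (V x \<inter> V y) \<ge> 2 * (card U - t) - card C\<close>, and
    \<open>card C \<le> card A - card U + 2 * t\<close> makes this at least
    \<open>card U - \<rho>\<close>. A common element \<open>v = x + u1 = y + u2\<close> modulo
    \<open>q\<close> yields \<open>u2\<close> with \<open>u2 - (x - y) = u1\<close>.\<close>
  have pop: "real (card U) - \<rho> \<le> real (card {u \<in> U. (u - (x - y)) mod q \<in> U})"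
    if xy: "x \<in> U" "y \<in> U" for x y
  proof -
    have "card (V x) + card (V y) \<le> card (V x \<inter> V y) + card C"
      using fin by (intro card_inter_ge) (auto simp: V_def)
    moreover have "card (V x \<inter> V y) \<le> card {u \<in> U. (u - (x - y)) mod q \<in> U}"
    proof (rule card_inj_on_le[of "\<lambda>v. (v - y) mod q"])
      show "inj_on (\<lambda>v. (v - y) mod q) (V x \<inter> V y)"
      proof (rule inj_onI)
        fix v w assume *: "v \<in> V x \<inter> V y" "w \<in> V x \<inter> V y" "(v - y) mod q = (w - y) mod q"
        from *(3) have "((v - y) mod q + y) mod q = ((w - y) mod q + y) mod q" by simp
        then have "v mod q = w mod q" by (simp add: mod_add_left_eq)
        then show "v = w" using *(1,2) q by (auto simp: V_def C_def)
      qed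
      show "(\<lambda>v. (v - y) mod q) ` (V x \<inter> V y) \<subseteq> {u \<in> U. (u - (x - y)) mod q \<in> U}"
      proof
        fix u assume "u \<in> (\<lambda>v. (v - y) mod q) ` (V x \<inter> V y)"
        then obtain v where v: "u = (v - y) mod q" "v \<in> V x" "v \<in> V y" by blast
        obtain u1 u2 where u12: "u1 \<in> U" "v = (x + u1) mod q" "u2 \<in> U" "v = (y + u2) mod q"
          using v(2,3) by (auto simp: V_def)
        have "u = u2 mod q" using v(1) u12(4) by (simp add: mod_diff_left_eq)
        then have u: "u = u2" using u12(3) U(1) by auto
        have "(u - (x - y)) mod q = (v - y - (x - y)) mod q"
          unfolding v(1) by (rule mod_diff_left_eq)
        also have "\<dots> = (v - x) mod q" by simp
        also have "\<dots> = u1 mod q" using u12(2) by (simp add: mod_diff_left_eq)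
        also have "\<dots> = u1" using u12(1) U(1) by auto
        finally show "u \<in> {u \<in> U. (u - (x - y)) mod q \<in> U}" using u u12 by simp
      qed
    qed (use fU in simp)
    ultimately show ?thesis using V[OF xy(1)] V[OF xy(2)] C G cU \<rho>(1) by linarith
  qed
  obtain g where g: "0 < g" "g dvd q" "\<And>u. u \<in> U \<Longrightarrow> g dvd u"
    "real_of_int (q div g) * (real (card U) - \<rho>) \<le> real (card U) ^ 2"
    using popular_differences[OF U pop] \<rho>(2) cU by auto
  have "B \<subseteq> arith_prog a g (nat (q div g) + 1)"
  proof
    fix b assume b: "b \<in> B"
    then have "b = a + q \<or> b - a \<in> U" using B_eq by auto
    then have "g dvd b - a" using g(2,3) by auto
    then obtain i where i: "b - a = g * i" by (auto simp: dvd_def)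
    have "0 \<le> g * i" "g * i \<le> g * (q div g)" using range[OF b] i g(2) by simp_all
    then have "0 \<le> i" "i \<le> q div g"
      using g(1) by (simp_all add: zero_le_mult_iff)
    then have "b = a + int (nat i) * g" "nat i < nat (q div g) + 1"
      using i by (simp_all add: mult.commute nat_mono le_imp_less_Suc)
    then show "b \<in> arith_prog a g (nat (q div g) + 1)" unfolding arith_prog_def by blast
  qed
  moreover have "real (nat (q div g) + 1) - 1 = real_of_int (q div g)"
    using g(1) q by (simp add: pos_imp_zdiv_nonneg_iff)
  ultimately show "\<exists>a g l. B \<subseteq> arith_prog a g l \<and>
      (real l - 1) * (real (card B) - 1 - \<rho>) \<le> (real (card B) - 1) ^ 2"
    using g(4) cU by (intro exI[of _ a] exI[of _ g] exI[of _ "nat (q div g) + 1"]) simp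
qed

section \<open>The container family and counting of subsets\<close>

text \<open>The exponent bounds the positive answers: \<open>k\<close> selections in the preliminary
  phase, \<open>Suc r * k\<close> in the later ones, the last of which may be incomplete, and
  \<open>Suc (m div d)\<close> absorptions.\<close>

lemma container_family:
  fixes m k d r :: nat and h \<beta> :: real
  assumes "0 < d" "2 * d \<le> k" "k \<le> 2 * m" "0 < h"
    and "real d * (2 * real m) \<le> real k * h" "3 * real m \<le> \<beta> + real r * h" "finite B"
  obtains F where "finite F" "card F \<le> (card B + 1) ^ (Suc r * k + k + Suc (m div d))"
    "\<forall>C\<in>F. finite C \<and> (real (card C) \<le> \<beta> \<or> nearly_closed m k (2 * h) C)"
    "\<forall>J. J \<subseteq> B \<and> card (sumset J J) \<le> m \<longrightarrow> (\<exists>C\<in>F. J \<subseteq> C)"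
proof -
  let ?P = "\<lambda>C. finite C \<and> (real (card C) \<le> \<beta> \<or> nearly_closed m k (2 * h) C)"
  have "covered ?P m {} B {}
      (Suc r * k + (k - card ({} :: int set)) + Suc ((m - card ({} :: int set)) div d))"
    by (rule covered_start[where h = h and \<beta> = \<beta>]) (use assms in simp_all)
  then obtain F where F: "finite F"
    "card F \<le> (card B + 1) ^ (Suc r * k + (k - card ({} :: int set)) + Suc ((m - card ({} :: int set)) div d))"
    "\<forall>C\<in>F. ?P C" "covers F m {} B {}"
    by (rule coveredE)
  show ?thesis
  proof (rule that[OF F(1)])
    show "card F \<le> (card B + 1) ^ (Suc r * k + k + Suc (m div d))" using F(2) by simp
    show "\<forall>C\<in>F. ?P C" by (rule F(3))
    show "\<forall>J. J \<subseteq> B \<and> card (sumset J J) \<le> m \<longrightarrow> (\<exists>C\<in>F. J \<subseteq> C)"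
      by (intro allI impI coversD[OF F(4)]) simp_all
  qed
qed

text \<open>Factor by factor, \<open>(b - i) / (N - i) \<le> b / N\<close>.\<close>

lemma binomial_le_power_ratio:
  assumes "b \<le> N" "0 < N"
  shows "real (b choose s) \<le> (real b / real N) ^ s * real (N choose s)"
proof (cases "s \<le> b")
  case True
  have "real (b choose s) = (\<Prod>i = 0..<s. real (b - i) / real (s - i))"
    using True by (simp add: binomial_altdef_of_nat)
  also have "\<dots> \<le> (\<Prod>i = 0..<s. (real b / real N) * (real (N - i) / real (s - i)))"
  proof (intro prod_mono conjI)
    fix i assume i: "i \<in> {0..<s}"
    have "real i * real b \<le> real i * real N" using assms by (intro mult_left_mono) auto
    then have "real (b - i) \<le> real b / real N * real (N - i)"
      using i True assms by (simp add: of_nat_diff field_simps)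
    then have "real (b - i) / real (s - i) \<le> real b / real N * real (N - i) / real (s - i)"
      by (rule divide_right_mono) simp
    then show "real (b - i) / real (s - i) \<le> (real b / real N) * (real (N - i) / real (s - i))"
      by simp
  qed simp
  also have "\<dots> = (real b / real N) ^ s * real (N choose s)"
    using True assms by (subst prod.distrib) (simp add: binomial_altdef_of_nat)
  finally show ?thesis .
qed (simp add: binomial_eq_0)

lemma card_subsets_of_members_le:
  assumes "finite F" "\<And>C. C \<in> F \<Longrightarrow> finite C \<and> card C \<le> b"
  shows "card {J. card J = s \<and> (\<exists>C\<in>F. J \<subseteq> C)} \<le> card F * (b choose s)"
proof -
  have "{J. card J = s \<and> (\<exists>C\<in>F. J \<subseteq> C)} = (\<Union>C\<in>F. {J. J \<subseteq> C \<and> card J = s})" by auto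
  also have "card \<dots> \<le> (\<Sum>C\<in>F. card {J. J \<subseteq> C \<and> card J = s})" by (rule card_UN_le[OF assms(1)])
  also have "\<dots> = (\<Sum>C\<in>F. card C choose s)" using assms(2) by (intro sum.cong) (simp_all add: n_subsets)
  also have "\<dots> \<le> (\<Sum>C\<in>F. b choose s)" using assms(2) by (intro sum_mono binomial_right_mono) simp
  finally show ?thesis by simp
qed

text \<open>Sums from \<open>{1..N}\<close> take at most \<open>2 * N\<close> values, so every
  \<open>s\<close>-subset of this interval qualifies. This bounds the sample space from
  below.\<close>

lemma binomial_le_card_small_doubling_sets:
  assumes "0 < N" "N \<le> n" "2 * real N \<le> K * real s"
  shows "N choose s \<le> card (small_doubling_sets n s K)"
proof -
  have "J \<in> small_doubling_sets n s K" if J: "J \<subseteq> {1..int N}" "card J = s" for J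
  proof -
    have "sumset J J \<subseteq> {1..int (2 * N)}" 
    proof
      fix z assume "z \<in> sumset J J"
      then obtain a b where ab: "z = a + b" "a \<in> J" "b \<in> J" by (auto simp: sumset_def)
      then have "a \<in> {1..int N}" "b \<in> {1..int N}" using J(1) by blast+
      then show "z \<in> {1..int (2 * N)}" using ab(1) by simp
    qed
    then have "card (sumset J J) \<le> 2 * N" using card_mono[of "{1..int (2 * N)}"] by (simp add: nat_mult_distrib)
    then show ?thesis using J assms by (auto simp: small_doubling_sets_def)
  qed
  then have sub: "{J. J \<subseteq> {1..int N} \<and> card J = s} \<subseteq> small_doubling_sets n s K" by blast
  have "finite (small_doubling_sets n s K)"
    by (rule finite_subset[of _ "Pow {1..int n}"]) (auto simp: small_doubling_sets_def)
  from card_mono[OF this sub] show ?thesis by (simp add: n_subsets)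
qed

section \<open>Large containers and the choice of parameters\<close>

text \<open>Deleting \<open>S\<close> leaves a set to which
  \<open>almost_closed_in_progression\<close> applies, with \<open>\<rho>\<close> of order
  \<open>x * m\<close>. The assumption \<open>3 \<le> x * m\<close> lets additive constants be
  absorbed.\<close>

lemma nearly_closed_progression:
  fixes m k :: nat and x t :: real
  assumes nc: "nearly_closed m k t B" and "finite B"
    and big: "real (card B) \<ge> (1 - 4 * x) * (real m - 1) / 2"
    and x: "0 < x" "x \<le> 1 / 2 ^ 20" "3 \<le> x * real m" "real k \<le> x * real m" "t \<le> 256 * x * real m"
  obtains S a g l where "S \<subseteq> B" "card S \<le> k" "B - S \<subseteq> arith_prog a g l"
    "real l \<le> real m / 2 + 2500 * x * real m"
proof -
  obtain A S where AS: "finite A" "card A \<le> m" "S \<subseteq> B" "card S \<le> k"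
    "\<And>b. b \<in> B - S \<Longrightarrow> real (misses A B b) < t"
    using nc unfolding nearly_closed_def by blast
  let ?N = "card (B - S)"
  define \<rho> where "\<rho> = real (card A) - 2 * real ?N + 4 * t + 2"
  \<comment> \<open>\<open>4 * t\<close> contributes 1024 and the deficit of \<open>2 * ?N\<close>
    below \<open>m\<close> contributes 6; the rest absorbs additive constants.\<close>
  define R where "R = 1040 * x * real m"
  have xm: "1000000 * (x * real m) \<le> real m" using mult_right_mono[OF x(2), of "real m"] by simp
  have "card B = ?N + card S"
    using AS(3) assms(2) by (metis card_Diff_subset card_mono finite_subset le_add_diff_inverse2)
  then have N: "real ?N \<ge> (1 - 4 * x) * (real m - 1) / 2 - x * real m"
    using big x(4) AS(4) by linarith
  then have N': "2 * real ?N \<ge> real m - 1 - 6 * (x * real m)" using x(1) by (simp add: algebra_simps)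
  have \<rho>: "\<rho> \<le> R" unfolding \<rho>_def R_def using N' x AS(2) by linarith
  have R: "2 * R < real ?N - 1" unfolding R_def using N' xm x by linarith
  have miss: "real (misses A (B - S) b) \<le> t" if "b \<in> B - S" for b
  proof -
    have "misses A (B - S) b \<le> misses A B b"
      unfolding misses_def using assms(2) by (intro card_mono) auto
    then show ?thesis using AS(5)[OF that] by linarith
  qed
  have "2 \<le> real ?N" using R x(3) unfolding R_def by linarith
  then have "2 \<le> ?N" by simp
  note prog = almost_closed_in_progression[OF AS(1) _ this miss \<rho>_def]
  have up: "2 * real ?N \<le> real m + 768 * (x * real m) + 2"
    using prog(1) assms(2) \<rho> R AS(2) x(5) by simp
  obtain a g l where l: "B - S \<subseteq> arith_prog a g l"
    "(real l - 1) * (real ?N - 1 - \<rho>) \<le> (real ?N - 1) ^ 2"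
    using prog(2) assms(2) \<rho> R by auto
  let ?y = "real ?N - 1"
  have "real l - 1 \<le> ?y + 2 * R"
  proof (rule ccontr)
    assume neg: "\<not> ?thesis"
    have R0: "0 \<le> R" using x(1) by (simp add: R_def)
    \<comment> \<open>The right side exceeds \<open>?y ^ 2\<close> by
      \<open>R * (?y - 2 * R) \<ge> 0\<close>.\<close>
    have "?y ^ 2 \<le> (?y + 2 * R) * (?y - R)"
      using mult_left_mono[OF less_imp_le[OF R] R0] by (simp add: algebra_simps power2_eq_square)
    also have "\<dots> < (real l - 1) * (?y - R)"
      using neg R R0 by (intro mult_strict_right_mono) linarith+
    also have "\<dots> \<le> (real l - 1) * (?y - \<rho>)"
      using neg R R0 \<rho> by (intro mult_left_mono) linarith+
    finally show False using l(2) by linarith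
  qed
  then have "real l \<le> real m / 2 + 2500 * (x * real m)"
    using up x(3) unfolding R_def by linarith
  then show ?thesis using that[OF AS(3,4) l(1)] by (simp add: mult.assoc)
qed

text \<open>
  Here \<open>x = (K / s) powr (1/6) * sqrt (ln n)\<close>, so \<open>x * s\<close> is the quantity \<open>E\<close> of the theorem.
\<close>

lemma doubling_container_estimate:
  fixes s n :: nat and K x L :: real
  defines "L \<equiv> ln (real n)"
  assumes s: "0 < s" "s \<le> n" and K: "2 \<le> K" and x: "0 < x" "x \<le> 1 / 2 ^ 20"
    and L: "2 / 3 \<le> L" and x6: "x ^ 6 * real s = K * L ^ 3"
    and Nn: "nat \<lfloor>K * real s / 2\<rfloor> \<le> n"
  defines "\<Omega> \<equiv> small_doubling_sets n s K"
  defines "good \<equiv> \<lambda>J. \<exists>T. T \<subseteq> J \<and> real (card T) \<le> 2 ^ 15 * (x * real s) \<and>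
    (\<exists>a d l. J - T \<subseteq> arith_prog a d l \<and> real l \<le> K * real s / 2 + 2 ^ 17 * (K * (x * real s)))"
  shows "real (card {J \<in> \<Omega>. \<not> good J}) \<le> exp (- (x * real s)) * real (card \<Omega>)"
proof -
  define M where "M = sqrt (K * real s)"
  define m where "m = nat \<lfloor>K * real s\<rfloor>"
  define N where "N = nat \<lfloor>K * real s / 2\<rfloor>"
  \<comment> \<open>With \<open>w\<close> of order \<open>1 / x\<close>, the choice
    \<open>h = 2 * m / w\<close> gives \<open>2 * h \<le> 256 * x * m\<close> and makes
    \<open>dk\<close> an equality. Taking \<open>d\<close> near \<open>M\<close> keeps the
    absorptions at about \<open>M\<close>; \<open>2 * w\<close> phases suffice because together they
    account for a drop of \<open>4 * m\<close>.\<close>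
  define w where "w = nat \<lceil>1 / (64 * x)\<rceil>"
  define d where "d = nat \<lceil>M\<rceil>"
  define k where "k = d * w"
  define h where "h = 2 * real m / real w"
  define \<beta> where "\<beta> = (1 - 4 * x) * real N"
  have Ks: "2 * real s \<le> K * real s" using K by (intro mult_right_mono) auto
  have M: "M ^ 2 = K * real s" "0 \<le> M" using K by (simp_all add: M_def)
  have "2 \<le> K * real s" using Ks s(1) by linarith
  then have M1: "1 \<le> M" unfolding M_def by simp
  have floor: "real (nat \<lfloor>y\<rfloor>) \<le> y" "y < real (nat \<lfloor>y\<rfloor>) + 1" if "0 \<le> y" for y :: real
    using that by (simp_all add: of_nat_floor)
  have ceil: "real (nat \<lceil>y\<rceil>) \<le> 2 * y" if "1 \<le> y" for y :: real
  proof -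
    have "real (nat \<lceil>y\<rceil>) = of_int \<lceil>y\<rceil>" using that by simp
    then show ?thesis using that of_int_ceiling_le_add_one[of y] by linarith
  qed
  have m: "real m \<le> K * real s" "K * real s < real m + 1"
    unfolding m_def using K by (intro floor; simp)+
  have N: "real N \<le> K * real s / 2" "K * real s / 2 < real N + 1"
    unfolding N_def using K by (intro floor; simp)+
  have "real s < real N + 1" using Ks N(2) by linarith
  then have sN: "s \<le> N" by simp
  \<comment> \<open>In other words \<open>x ^ 3 * s = M * L powr (3/2)\<close>. The size of
    \<open>x\<close> is set so that \<open>M * L / x ^ 2\<close>, which governs the logarithm of the
    number of containers, is at most a constant times \<open>x * s\<close>.\<close>
  have x3: "(x ^ 3 * real s) ^ 2 = K * real s * L ^ 3"
  proof -
    have "(x ^ 3 * real s) ^ 2 = (x ^ 6 * real s) * real s"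
      by (simp add: power_mult_distrib power2_eq_square eval_nat_numeral)
    then show ?thesis unfolding x6 by simp
  qed
  have M_le: "M \<le> 2 * (x ^ 3 * real s)"
  proof (rule power2_le_imp_le)
    have "(2 / 3 :: real) ^ 3 \<le> L ^ 3" using L by (intro power_mono) auto
    then have "1 \<le> 4 * L ^ 3" by (simp add: power3_eq_cube)
    then have "K * real s * 1 \<le> K * real s * (4 * L ^ 3)" using K by (intro mult_left_mono) auto
    then show "M ^ 2 \<le> (2 * (x ^ 3 * real s)) ^ 2"
      using x3 M(1) by (simp add: power_mult_distrib)
  qed (use x in simp)
  have LM_le: "M * L \<le> 2 * (x ^ 3 * real s)"
  proof (rule power2_le_imp_le)
    have "L ^ 2 * 1 \<le> L ^ 2 * (4 * L)" using L by (intro mult_left_mono) auto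
    then have "K * real s * L ^ 2 \<le> K * real s * (4 * L ^ 3)"
      using K by (intro mult_left_mono) (auto simp: power2_eq_square power3_eq_cube)
    then show "(M * L) ^ 2 \<le> (2 * (x ^ 3 * real s)) ^ 2"
      using x3 M(1) by (simp add: power_mult_distrib)
  qed (use x in simp)
  have w: "1 / (64 * x) \<le> real w" "real w \<le> 1 / (32 * x)"
  proof -
    have "1 \<le> 1 / (64 * x)" using x by (simp add: field_simps)
    moreover have "1 / (32 * x) = 2 * (1 / (64 * x))" by simp
    ultimately show "1 / (64 * x) \<le> real w" "real w \<le> 1 / (32 * x)"
      unfolding w_def using ceil[of "1 / (64 * x)"] by (auto simp only: real_nat_ceiling_ge)
  qed
  have w2: "2 \<le> real w" using w(1) x by (intro order_trans[OF _ w(1)]) (simp add: field_simps)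
  then have w2': "2 \<le> w" by simp
  have d: "M \<le> real d" "real d \<le> 2 * M" using ceil[OF M1] by (simp_all add: d_def real_nat_ceiling_ge)
  then have d0: "0 < d" using M1 by (cases d) auto
  have k: "real k \<le> x ^ 2 * real s / 8"
  proof -
    have "real k \<le> 2 * M * (1 / (32 * x))"
      unfolding k_def of_nat_mult using d(2) w(2) M(2) by (intro mult_mono) auto
    also have "\<dots> \<le> 2 * (2 * (x ^ 3 * real s)) * (1 / (32 * x))"
      using x by (intro mult_right_mono mult_left_mono M_le) auto
    also have "\<dots> = x ^ 2 * real s / 8" using x by (simp add: field_simps eval_nat_numeral)
    finally show ?thesis .
  qed
  have x2: "x ^ 2 \<le> 1 / 2 ^ 40"
    using power_mono[OF x(2), of 2] x(1) by (simp add: power_divide)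
  \<comment> \<open>Since \<open>M \<ge> 1\<close> while \<open>x ^ 2\<close> is tiny,
    \<open>M_le\<close> forces \<open>x * s\<close> to be large.\<close>
  have "1 \<le> 2 * x ^ 2 * (x * real s)"
    using M1 M_le by (simp add: eval_nat_numeral algebra_simps)
  also have "\<dots> \<le> 2 * (1 / 2 ^ 40) * (x * real s)" using x2 x(1) by (intro mult_right_mono) auto
  finally have xs: "4 \<le> x * real s" by simp
  have sm: "real s \<le> real m" using m(2) Ks s(1) by linarith
  then have xsm: "x * real s \<le> x * real m" using x(1) by simp
  have "x ^ 2 * real s \<le> x * real s"
    using x by (simp add: power2_eq_square mult_left_le_one_le)
  then have kx: "real k \<le> x * real s" using k xs by linarith
  have "x * real m \<le> real m" using x by (simp add: mult_left_le_one_le)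
  then have "real k \<le> real m" using kx xsm by linarith
  then have km: "k \<le> 2 * m" by simp
  have m0: "0 < m" using sm s(1) by linarith
  have h0: "0 < h" using m0 w2 by (simp add: h_def)
  have dk: "real d * (2 * real m) \<le> real k * h" using w2 by (simp add: h_def k_def)
  have "0 \<le> \<beta>" using x by (simp add: \<beta>_def)
  then have r: "3 * real m \<le> \<beta> + real (2 * w) * h" using w2 by (simp add: h_def)
  have dk2: "2 * d \<le> k" using w2' by (simp add: k_def)
  obtain F where F: "finite F"
    "card F \<le> (card {1..int n} + 1) ^ (Suc (2 * w) * k + k + Suc (m div d))"
    "\<forall>C\<in>F. finite C \<and> (real (card C) \<le> \<beta> \<or> nearly_closed m k (2 * h) C)"
    "\<forall>J. J \<subseteq> {1..int n} \<and> card (sumset J J) \<le> m \<longrightarrow> (\<exists>C\<in>F. J \<subseteq> C)"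
    by (rule container_family[OF d0 dk2 km h0 dk r, of "{1..int n}"]) simp
  define q where "q = Suc (2 * w) * k + k + Suc (m div d)"
  have q: "real q \<le> M / (100 * x ^ 2)"
  proof -
    have "real (m div d) \<le> real m / real d" by (rule of_nat_div_le_of_nat)
    also have "\<dots> \<le> (M * M) / M"
      using m(1) M d(1) M1 by (intro frac_le) (auto simp: power2_eq_square)
    finally have md: "real (m div d) \<le> M" using M1 by simp
    have "real q = real (2 * w + 2) * real k + (real (m div d) + 1)"
      by (simp add: q_def algebra_simps)
    also have "\<dots> \<le> 3 * real w * (2 * M * real w) + 2 * M"
      using w2 d(2) M(2) M1 md by (intro add_mono mult_mono) (auto simp: k_def intro: mult_right_mono)
    also have "\<dots> = 6 * M * (real w) ^ 2 + 2 * M" by (simp add: power2_eq_square)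
    also have "\<dots> \<le> 6 * M * (1 / (32 * x)) ^ 2 + 2 * M"
      using w(2) M(2) by (intro add_right_mono mult_left_mono power_mono) auto
    also have "\<dots> = M / (100 * x ^ 2) * (600 / 1024 + 200 * x ^ 2)"
      using x by (simp add: field_simps power2_eq_square)
    also have "\<dots> \<le> M / (100 * x ^ 2) * 1"
      using x2 M(2) by (intro mult_left_mono) auto
    finally show ?thesis by simp
  qed
  have cF: "real (card F) \<le> exp (x * real s / 25)"
  proof -
    have n2: "2 \<le> n"
    proof (rule ccontr)
      assume "\<not> 2 \<le> n"
      then have "n = 1" using s by linarith
      then show False using L by (simp add: L_def)
    qed
    have "real n * 2 \<le> real n * real n" using n2 by (intro mult_left_mono) auto
    then have "real n + 1 \<le> real n * real n" using n2 by linarith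
    also have "\<dots> = exp (2 * L)" using n2 by (simp add: L_def exp_double power2_eq_square)
    finally have base: "real n + 1 \<le> exp (2 * L)" .
    have "real (card F) \<le> real ((card {1..int n} + 1) ^ q)"
      using F(2) unfolding q_def[symmetric] by (rule of_nat_mono)
    also have "\<dots> = (real n + 1) ^ q" by (simp add: add.commute)
    also have "\<dots> \<le> exp (2 * L) ^ q" using base by (intro power_mono) auto
    also have "\<dots> = exp (2 * L * real q)" by (simp add: exp_of_nat_mult mult.commute)
    also have "2 * L * real q \<le> 2 * L * (M / (100 * x ^ 2))"
      using q L by (intro mult_left_mono) auto
    also have "\<dots> = M * L / (50 * x ^ 2)" by simp
    also have "\<dots> \<le> 2 * (x ^ 3 * real s) / (50 * x ^ 2)"
      using LM_le by (intro divide_right_mono) auto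
    also have "\<dots> = x * real s / 25" using x by (simp add: field_simps eval_nat_numeral)
    finally show ?thesis by simp
  qed
  define F' where "F' = {C \<in> F. real (card C) \<le> \<beta>}"
  have bad: "{J \<in> \<Omega>. \<not> good J} \<subseteq> {J. card J = s \<and> (\<exists>C\<in>F'. J \<subseteq> C)}"
  proof
    fix J assume "J \<in> {J \<in> \<Omega>. \<not> good J}"
    then have J: "J \<subseteq> {1..int n}" "card J = s" "real (card (sumset J J)) \<le> K * real s" "\<not> good J"
      by (auto simp: \<Omega>_def small_doubling_sets_def)
    have "real (card (sumset J J)) < real m + 1" using J(3) m(2) by linarith
    then have "card (sumset J J) \<le> m" by simp
    then obtain C where C: "C \<in> F" "J \<subseteq> C" using F(4)[rule_format, of J] J(1) by blast
    \<comment> \<open>Otherwise \<open>C\<close> is nearly closed, and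
      \<open>T = J \<inter> S\<close> witnesses that \<open>J\<close> is good.\<close>
    have "real (card C) \<le> \<beta>"
    proof (rule ccontr)
      assume big: "\<not> real (card C) \<le> \<beta>"
      then have nc: "nearly_closed m k (2 * h) C" and fC: "finite C" using F(3) C(1) by blast+
      \<comment> \<open>Rounding down both \<open>K * s\<close> and its half costs at most one,
        whence the \<open>m - 1\<close> in \<open>nearly_closed_progression\<close>.\<close>
      have "real m < real (2 * N + 2)" using m(1) N(2) by simp
      then have "m \<le> 2 * N + 1" by simp
      then have "real m - 1 \<le> 2 * real N" by linarith
      then have "(1 - 4 * x) * (real m - 1) \<le> (1 - 4 * x) * (2 * real N)"
        using x by (intro mult_left_mono) auto
      then have big': "(1 - 4 * x) * (real m - 1) / 2 \<le> real (card C)"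
        using big by (simp add: \<beta>_def)
      have "2 * h = 4 * real m * (1 / real w)" by (simp add: h_def)
      also have "\<dots> \<le> 4 * real m * (64 * x)"
        using w x w2 by (intro mult_left_mono) (auto simp: field_simps)
      finally have t: "2 * h \<le> 256 * x * real m" by simp
      have xm: "3 \<le> x * real m" "real k \<le> x * real m" using xs xsm kx by linarith+
      obtain S a g l where S: "S \<subseteq> C" "card S \<le> k" "C - S \<subseteq> arith_prog a g l"
        "real l \<le> real m / 2 + 2500 * x * real m"
        by (rule nearly_closed_progression[OF nc fC big' x xm t])
      have "card (J \<inter> S) \<le> card S"
        using S(1) fC by (intro card_mono) (auto intro: finite_subset)
      then have "real (card (J \<inter> S)) \<le> 2 ^ 15 * (x * real s)"
        using S(2) kx xs by simp
      moreover have "J - J \<inter> S \<subseteq> arith_prog a g l" using S(3) C(2) by blast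
      moreover have "real l \<le> K * real s / 2 + 2 ^ 17 * (K * (x * real s))"
      proof -
        have "x * real m \<le> x * (K * real s)" using m(1) x by (intro mult_left_mono) auto
        moreover have "0 \<le> x * real m" using x by simp
        ultimately show ?thesis using S(4) m(1) by (simp add: algebra_simps)
      qed
      ultimately have "good J" unfolding good_def by blast
      then show False using J(4) by blast
    qed
    then show "J \<in> {J. card J = s \<and> (\<exists>C\<in>F'. J \<subseteq> C)}" using C J(2) by (auto simp: F'_def)
  qed
  define b where "b = nat \<lfloor>\<beta>\<rfloor>"
  have N0: "0 < N" using sN s(1) by simp
  have b: "real b \<le> (1 - 4 * x) * real N" using \<open>0 \<le> \<beta>\<close> by (simp add: b_def \<beta>_def)
  also have "\<dots> \<le> real N" using x by (intro mult_left_le_one_le) auto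
  finally have bN: "b \<le> N" by simp
  have F': "finite F'" "card F' \<le> card F" using F(1) by (auto simp: F'_def intro: card_mono)
  have F'_fin: "finite C \<and> card C \<le> b" if "C \<in> F'" for C
    using that F(3) by (auto simp: F'_def b_def le_nat_floor)
  have "finite {J. card J = s \<and> (\<exists>C\<in>F'. J \<subseteq> C)}"
    by (rule finite_subset[of _ "\<Union>C\<in>F'. Pow C"]) (use F' F'_fin in auto)
  then have "card {J \<in> \<Omega>. \<not> good J} \<le> card F' * (b choose s)"
    using card_mono[OF _ bad] card_subsets_of_members_le[OF F'(1) F'_fin] by (meson order_trans)
  also have "\<dots> \<le> card F * (b choose s)" using F'(2) by simp
  finally have "real (card {J \<in> \<Omega>. \<not> good J}) \<le> real (card F * (b choose s))"
    by (rule of_nat_mono)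
  \<comment> \<open>Each small container holds at most a fraction \<open>(1 - 4 * x) ^ s\<close> of
    the number of \<open>s\<close>-subsets of \<open>{1..N}\<close>; this outweighs the factor
    \<open>exp (x * s / 25)\<close> for the number of containers.\<close>
  also have "\<dots> \<le> exp (x * real s / 25) * (exp (- (4 * x * real s)) * real (card \<Omega>))"
  proof -
    have "real b / real N \<le> 1 - 4 * x" using b N0 by (simp add: field_simps)
    also have "\<dots> \<le> exp (- (4 * x))" using exp_ge_add_one_self[of "- (4 * x)"] by simp
    finally have "(real b / real N) ^ s \<le> exp (- (4 * x)) ^ s" by (intro power_mono) auto
    also have "\<dots> = exp (- (4 * x * real s))" by (simp add: exp_of_nat_mult[symmetric] algebra_simps)
    finally have "(real b / real N) ^ s \<le> exp (- (4 * x * real s))" .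
    moreover have "N choose s \<le> card \<Omega>"
      unfolding \<Omega>_def using N0 Nn N(1) by (intro binomial_le_card_small_doubling_sets) (auto simp: N_def)
    ultimately have "(real b / real N) ^ s * real (N choose s) \<le> exp (- (4 * x * real s)) * real (card \<Omega>)"
      by (intro mult_mono) auto
    then have "real (b choose s) \<le> exp (- (4 * x * real s)) * real (card \<Omega>)"
      using binomial_le_power_ratio[OF bN N0, of s] by linarith
    then show ?thesis unfolding of_nat_mult using cF by (intro mult_mono) auto
  qed
  also have "\<dots> = exp (x * real s / 25 + - (4 * x * real s)) * real (card \<Omega>)"
    by (simp only: exp_add mult.assoc)
  also have "\<dots> \<le> exp (- (x * real s)) * real (card \<Omega>)"
    using xs by (intro mult_right_mono) auto
  finally show ?thesis .
qed

theorem theorem5p1: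
  fixes s n :: nat and K :: real
  assumes "s > 0" and "n > 0"
    and "2 \<le> K" and "K \<le> real s / (2 ^ 120 * (ln (real n)) ^ 3)"
  defines "\<Omega> \<equiv> small_doubling_sets n s K"
  defines "E \<equiv> K powr (1/6) * real s powr (5/6) * sqrt (ln (real n))"
  shows "real (card {J \<in> \<Omega>. \<exists>T. T \<subseteq> J \<and> real (card T) \<le> 2 ^ 15 * E \<and>
            (\<exists>a d m. J - T \<subseteq> arith_prog a d m \<and>
               real m \<le> K * real s / 2 + 2 ^ 17 * K powr (7/6) * real s powr (5/6) * sqrt (ln (real n)))})
         \<ge> (1 - exp (- E)) * real (card \<Omega>)"
proof -
  let ?b = "K * real s / 2 + 2 ^ 17 * K powr (7/6) * real s powr (5/6) * sqrt (ln (real n))"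
  define good where "good = (\<lambda>J. \<exists>T. T \<subseteq> J \<and> real (card T) \<le> 2 ^ 15 * E \<and>
    (\<exists>a d m. J - T \<subseteq> arith_prog a d m \<and> real m \<le> ?b))"
  define L where "L = ln (real n)"
  define x where "x = E / real s"
  \<comment> \<open>For \<open>n = 1\<close> the logarithm vanishes and division by zero gives
    \<open>0\<close>, contradicting \<open>2 \<le> K\<close>.\<close>
  have "n \<noteq> 1" using assms(3,4) by auto
  then have n2: "2 \<le> n" using assms(2) by linarith
  have "ln 2 \<le> L" using n2 by (simp add: L_def)
  then have L: "2 / 3 \<le> L" using ln2_ge_two_thirds by linarith
  have E0: "0 < E" unfolding E_def using assms(1,3) L by (simp add: L_def)
  have E6: "E ^ 6 = K * real s ^ 5 * L ^ 3"
  proof -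
    have "(K powr (1/6)) ^ 6 = K" using assms(3) by (simp add: powr_power)
    moreover have "(real s powr (5/6)) ^ 6 = real s ^ 5"
      using assms(1) by (simp add: powr_power)
    moreover have "sqrt L ^ 6 = (sqrt L ^ 2) ^ 3" by (simp flip: power_mult)
    then have "sqrt L ^ 6 = L ^ 3" using L by simp
    ultimately show ?thesis unfolding E_def L_def[symmetric] by (simp add: power_mult_distrib)
  qed
  have x0: "0 < x" using E0 assms(1) by (simp add: x_def)
  have x6: "x ^ 6 * real s = K * L ^ 3"
    using E6 assms(1) by (simp add: x_def power_divide eval_nat_numeral)
  \<comment> \<open>Sixth powers reduce this to the hypothesis on \<open>K\<close>:
    \<open>x ^ 6 * s = K * L ^ 3 \<le> s / 2 ^ 120\<close>.\<close>
  have "x \<le> 1 / 2 ^ 20"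
  proof (rule power_le_imp_le_base[where n = 5])
    have "K * (2 ^ 120 * L ^ 3) \<le> real s"
      using assms(4) L unfolding L_def[symmetric] by (simp add: pos_le_divide_eq)
    then have "x ^ 6 * real s * 2 ^ 120 \<le> 1 * real s" unfolding x6 by (simp add: mult_ac)
    then have "x ^ 6 * 2 ^ 120 \<le> 1" using assms(1) by simp
    then show "x ^ Suc 5 \<le> (1 / 2 ^ 20) ^ Suc 5" by (simp add: power_divide)
  qed simp
  have xE: "x * real s = E" using assms(1) by (simp add: x_def)
  have fin: "finite \<Omega>" unfolding \<Omega>_def
    by (rule finite_subset[of _ "Pow {1..int n}"]) (auto simp: small_doubling_sets_def)
  have "K powr (7/6) = K * K powr (1/6)"
    using assms(3) powr_add[of K 1 "1/6"] by simp
  then have b: "?b = K * real s / 2 + 2 ^ 17 * (K * E)" by (simp add: E_def)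
  have "real (card {J \<in> \<Omega>. \<not> good J}) \<le> exp (- E) * real (card \<Omega>)"
  proof (cases "s \<le> n \<and> nat \<lfloor>K * real s / 2\<rfloor> \<le> n")
    case True
    have "real (card {J \<in> \<Omega>. \<not> good J}) \<le> exp (- (x * real s)) * real (card \<Omega>)"
      using True assms(1,3) x0 \<open>x \<le> 1 / 2 ^ 20\<close> L x6 unfolding \<Omega>_def good_def b xE[symmetric] L_def
      by (intro doubling_container_estimate) auto
    then show ?thesis unfolding xE .
  next
    case False
    \<comment> \<open>If \<open>s > n\<close> no such \<open>J\<close> exists; otherwise
      \<open>n \<le> K * s / 2\<close>, and \<open>{1..n}\<close> itself is the progression, with
      \<open>T\<close> empty.\<close>
    have "good J" if J: "J \<in> \<Omega>" for J
    proof -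
      have J: "J \<subseteq> {1..int n}" "card J = s" using J by (auto simp: \<Omega>_def small_doubling_sets_def)
      then have "s \<le> n" using card_mono[of "{1..int n}" J] by simp
      then have "n < nat \<lfloor>K * real s / 2\<rfloor>" using False by simp
      then have "real n \<le> K * real s / 2" by linarith
      moreover have "0 \<le> K * E" using assms(3) E0 by simp
      ultimately have "real n \<le> ?b" unfolding b by (intro add_increasing2) simp_all
      moreover have "J - {} \<subseteq> arith_prog 1 1 n"
      proof
        fix z assume "z \<in> J - {}"
        then have "z \<in> {1..int n}" using J(1) by blast
        then have "z = 1 + int (nat (z - 1)) * 1" "nat (z - 1) < n" by (auto simp: nat_less_iff)
        then show "z \<in> arith_prog 1 1 n" unfolding arith_prog_def by blast
      qed
      moreover have "real (card ({} :: int set)) \<le> 2 ^ 15 * E" using E0 by simp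
      ultimately show ?thesis unfolding good_def by blast
    qed
    then have none: "{J \<in> \<Omega>. \<not> good J} = {}" by blast
    show ?thesis unfolding none by simp
  qed
  moreover have "card \<Omega> = card {J \<in> \<Omega>. good J} + card {J \<in> \<Omega>. \<not> good J}"
    using fin by (subst card_Un_disjoint[symmetric]) (auto intro: arg_cong[where f = card])
  ultimately have "(1 - exp (- E)) * real (card \<Omega>) \<le> real (card {J \<in> \<Omega>. good J})"
    by (simp add: algebra_simps)
  then show ?thesis unfolding good_def .
qed

end
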